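(* Let $H$ be a $d$-regular graph on $k$ labelled vertices, let $\bar a\in(0,1)$, and let $\mu_2\ge\dots\ge\mu_k$ be the eigenvalues of the adjacency matrix $A_H$ of $H$ on $\mathbf 1^\perp=\{y\in\mathbb R^k:\sum_iy_i=0\}$, so that the eigenvalues of $Q_H$ (defined in the context) on $\mathbf 1^\perp$ are $$q_i=\tfrac18\Bigl[\tfrac d{\bar a^2}+\tfrac{k-2-d}{(1-\bar a)^2}+\bigl(\tfrac1{\bar a^2}-\tfrac1{(1-\bar a)^2}\bigr)\mu_i\Bigr],\qquad i=2,\dots,k.$$ If $\bar a\le1/2$ then $q_i\ge\dfrac{k-2}{8(1-\bar a)^2}$ for every $i$.
   Context: $Q_H=\tfrac18\bigl[\bigl(\tfrac{d}{\bar a^2}+\tfrac{k-2-d}{(1-\bar a)^2}\bigr)I+\bigl(\tfrac1{\bar a^2}-\tfrac1{(1-\bar a)^2}\bigr)A_H\bigr]$. *)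

theory Defs imports "HOL-Analysis.Analysis" begin

definition simple_graph :: "('n \<Rightarrow> 'n \<Rightarrow> bool) \<Rightarrow> bool" where
  "simple_graph H \<longleftrightarrow> symp H \<and> irreflp H"

definition regular_of_degree :: "nat \<Rightarrow> ('n::finite \<Rightarrow> 'n \<Rightarrow> bool) \<Rightarrow> bool" where
  "regular_of_degree d H \<longleftrightarrow> (\<forall>v. card {u. H v u} = d)"

definition adj_matrix :: "('n::finite \<Rightarrow> 'n \<Rightarrow> bool) \<Rightarrow> real ^ 'n ^ 'n" where
  "adj_matrix H = (\<chi> u v. if H u v then 1 else 0)"

definition ones_perp :: "(real ^ 'n::finite) set" where
  "ones_perp = {y. (\<Sum>i\<in>UNIV. y $ i) = 0}"

(* The family mu, indexed by the finite set I, lists the eigenvalues of A on the subspace W with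
   multiplicity: every real x occurs as often as the dimension of the x-eigenspace of A in W
   (so not at all if x is not an eigenvalue). It is used for symmetric A and A-invariant W, where
   geometric and algebraic multiplicities coincide and all eigenvalues are real. *)
definition lists_eigenvalues_on ::
    "real ^ 'n::finite ^ 'n \<Rightarrow> (real ^ 'n) set \<Rightarrow> nat set \<Rightarrow> (nat \<Rightarrow> real) \<Rightarrow> bool" where
  "lists_eigenvalues_on A W I \<mu> \<longleftrightarrow>
     finite I \<and> (\<forall>x. card {i \<in> I. \<mu> i = x} = dim {y \<in> W. A *v y = x *\<^sub>R y})"

(* d is meant to be the degree of the regular graph H; CARD('n) is the number k of vertices. *)
definition Q_matrix :: "('n::finite \<Rightarrow> 'n \<Rightarrow> bool) \<Rightarrow> nat \<Rightarrow> real \<Rightarrow> real ^ 'n ^ 'n" where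
  "Q_matrix H d a = (1 / 8) *\<^sub>R
     ((real d / a\<^sup>2 + (real CARD('n) - 2 - real d) / (1 - a)\<^sup>2) *\<^sub>R mat 1
      + (1 / a\<^sup>2 - 1 / (1 - a)\<^sup>2) *\<^sub>R adj_matrix H)"

end

theory Submission imports Defs begin

text \<open>
  The matrix \<open>Q_matrix H d a\<close> has the form \<open>s I + c A\<close> with \<open>A\<close> the adjacency matrix, \<open>s\<close> and \<open>c\<close>
  scalars. If \<open>c \<noteq> 0\<close>, the \<open>x\<close>-eigenspace of \<open>A\<close> is the \<open>(s + c x)\<close>-eigenspace of \<open>s I + c A\<close>, so
  the affine map \<open>x \<mapsto> s + c x\<close> carries one list of eigenvalues, with multiplicities, to the other.
  The value \<open>a = 1/2\<close> gives \<open>c = 0\<close>: all eigenvalues collapse to \<open>s\<close>, and the multiplicity is right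
  because the list has \<open>k - 1\<close> entries, the dimension of the hyperplane orthogonal to the all-ones
  vector. Both cases are in \<open>lists_eigenvalues_on_affine\<close>.

  The lower bound rests on \<open>\<mu> \<ge> - d\<close>, valid for all eigenvalues of a \<open>d\<close>-regular graph
  (\<open>regular_eigenvalue_abs_le\<close>). For \<open>a \<le> 1/2\<close> the coefficient \<open>1 / a\<^sup>2 - 1 / (1 - a)\<^sup>2\<close> of \<open>\<mu>\<close> is
  nonnegative, so \<open>q\<close> is smallest when \<open>\<mu> = - d\<close>; there the terms in \<open>d\<close> cancel, and what
  remains is \<open>(k - 2) / (8 (1 - a)\<^sup>2)\<close>.
\<close>

lemma ones_perp_hyperplane: "(ones_perp :: (real ^ 'n::finite) set) = {y. 1 \<bullet> y = 0}"
  by (simp add: ones_perp_def inner_vec_def)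

lemma subspace_ones_perp: "subspace (ones_perp :: (real ^ 'n::finite) set)"
  unfolding ones_perp_hyperplane by (rule subspace_hyperplane)

lemma dim_ones_perp: "dim (ones_perp :: (real ^ 'n::finite) set) = CARD('n) - 1"
proof -
  have "(1 :: real ^ 'n) \<noteq> 0"
    by (simp add: vec_eq_iff)
  then show ?thesis
    unfolding ones_perp_hyperplane by (simp add: dim_hyperplane)
qed

lemma affine_matrix_vector_mult:
  fixes A :: "real ^ 'n::finite ^ 'n"
  shows "(s *\<^sub>R mat 1 + c *\<^sub>R A) *v y = s *\<^sub>R y + c *\<^sub>R (A *v y)"
  by (simp add: matrix_vector_mult_add_rdistrib scaleR_matrix_vector_assoc [symmetric])

text \<open>
  The hypotheses on \<open>W\<close> serve the degenerate case \<open>c = 0\<close>, where the eigenspace of \<open>s\<close> is all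
  of \<open>W\<close> and the length of the list has to agree with its dimension. Equality of length
  and dimension means that \<open>W\<close> is spanned by eigenvectors of \<open>A\<close>.
\<close>

lemma lists_eigenvalues_on_affine:
  fixes A :: "real ^ 'n::finite ^ 'n"
  assumes A: "lists_eigenvalues_on A W I \<mu>"
    and W: "subspace W" "card I = dim W"
    and q: "\<And>i. i \<in> I \<Longrightarrow> q i = s + c * \<mu> i"
  shows "lists_eigenvalues_on (s *\<^sub>R mat 1 + c *\<^sub>R A) W I q"
proof -
  have "card {i \<in> I. q i = x} = dim {y \<in> W. (s *\<^sub>R mat 1 + c *\<^sub>R A) *v y = x *\<^sub>R y}" for x
  proof (cases "c = 0")
    case True
    show ?thesis
    proof (cases "x = s")
      case True
      have "{i \<in> I. q i = x} = I"
        using q \<open>c = 0\<close> True by auto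
      moreover have "{y \<in> W. (s *\<^sub>R mat 1 + c *\<^sub>R A) *v y = x *\<^sub>R y} = W"
        using \<open>c = 0\<close> True unfolding affine_matrix_vector_mult by auto
      ultimately show ?thesis
        using W by simp
    next
      case False
      have "{i \<in> I. q i = x} = {}"
        using q \<open>c = 0\<close> False by auto
      moreover have "{y \<in> W. (s *\<^sub>R mat 1 + c *\<^sub>R A) *v y = x *\<^sub>R y} = {0}"
        using \<open>c = 0\<close> False subspace_0 [OF W(1)] unfolding affine_matrix_vector_mult by auto
      ultimately show ?thesis
        by (metis card.empty dim_singleton)
    qed
  next
    case False
    have "{i \<in> I. q i = x} = {i \<in> I. \<mu> i = (x - s) / c}"
      using q False by (auto simp: field_simps)
    moreover have "s *\<^sub>R y + c *\<^sub>R (A *v y) = x *\<^sub>R y \<longleftrightarrow> A *v y = ((x - s) / c) *\<^sub>R y" for y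
      using False by (auto simp: vec_eq_iff field_simps)
    ultimately show ?thesis
      using A unfolding lists_eigenvalues_on_def affine_matrix_vector_mult by simp
  qed
  then show ?thesis
    using A by (simp add: lists_eigenvalues_on_def)
qed

lemma adj_matrix_mult_nth: "(adj_matrix H *v y) $ v = (\<Sum>u | H v u. y $ u)"
proof -
  have "(adj_matrix H *v y) $ v = (\<Sum>u\<in>UNIV. if H v u then y $ u else 0)"
    unfolding adj_matrix_def matrix_vector_mult_def by (auto intro!: sum.cong)
  also have "\<dots> = (\<Sum>u | H v u. y $ u)"
    by (simp add: sum.If_cases)
  finally show ?thesis .
qed

text \<open>
  At a vertex \<open>v\<close> where the eigenvector has its largest absolute value, the eigenvalue equation
  writes \<open>x y\<^sub>v\<close> as a sum over the \<open>d\<close> neighbours of \<open>v\<close>, each term being at most \<open>\<bar>y\<^sub>v\<bar>\<close> in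
  absolute value. Dividing by \<open>\<bar>y\<^sub>v\<bar> > 0\<close> gives the bound.
\<close>

lemma regular_eigenvalue_abs_le:
  fixes H :: "'n::finite \<Rightarrow> 'n \<Rightarrow> bool"
  assumes reg: "regular_of_degree d H"
    and eig: "adj_matrix H *v y = x *\<^sub>R y" and "y \<noteq> 0"
  shows "\<bar>x\<bar> \<le> real d"
proof -
  obtain v where v: "\<And>u. \<bar>y $ u\<bar> \<le> \<bar>y $ v\<bar>"
  proof -
    let ?S = "range (\<lambda>u. \<bar>y $ u\<bar>)"
    have "Max ?S \<in> ?S"
      by (rule Max_in) auto
    then obtain v where "Max ?S = \<bar>y $ v\<bar>"
      by blast
    then have "\<bar>y $ u\<bar> \<le> \<bar>y $ v\<bar>" for u
      using Max_ge [of ?S "\<bar>y $ u\<bar>"] by simp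
    then show thesis
      by (rule that)
  qed
  obtain w where "y $ w \<noteq> 0"
    using \<open>y \<noteq> 0\<close> by (auto simp: vec_eq_iff)
  then have pos: "0 < \<bar>y $ v\<bar>"
    using v [of w] by linarith
  have "\<bar>x\<bar> * \<bar>y $ v\<bar> = \<bar>\<Sum>u | H v u. y $ u\<bar>"
    using arg_cong [OF eig, of "\<lambda>z. z $ v"] by (simp add: adj_matrix_mult_nth abs_mult)
  also have "\<dots> \<le> (\<Sum>u | H v u. \<bar>y $ u\<bar>)"
    by (rule sum_abs)
  also have "\<dots> \<le> (\<Sum>u | H v u. \<bar>y $ v\<bar>)"
    by (intro sum_mono v)
  also have "\<dots> = real d * \<bar>y $ v\<bar>"
    using reg by (simp add: regular_of_degree_def)
  finally show ?thesis
    using pos by simp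
qed

lemma lists_eigenvalues_on_eigenvector:
  assumes "lists_eigenvalues_on A W I \<mu>" and "i \<in> I"
  obtains y where "y \<in> W" "y \<noteq> 0" "A *v y = \<mu> i *\<^sub>R y"
proof -
  have "finite I" and "card {j \<in> I. \<mu> j = \<mu> i} = dim {y \<in> W. A *v y = \<mu> i *\<^sub>R y}"
    using assms(1) by (auto simp: lists_eigenvalues_on_def)
  moreover have "card {j \<in> I. \<mu> j = \<mu> i} \<noteq> 0"
    using \<open>finite I\<close> \<open>i \<in> I\<close> by auto
  ultimately have "\<not> {y \<in> W. A *v y = \<mu> i *\<^sub>R y} \<subseteq> {0}"
    by (metis dim_eq_0)
  then show thesis
    using that by blast
qed

text \<open>
  The difference of the two sides is \<open>(1 / a\<^sup>2 - 1 / (1 - a)\<^sup>2) (d + m) / 8\<close>.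
\<close>

lemma affine_eigenvalue_lower_bound:
  fixes a d k m :: real
  assumes "0 < a" "a \<le> 1 / 2" and m: "- d \<le> m"
  shows "(k - 2) / (8 * (1 - a)\<^sup>2)
    \<le> 1 / 8 * (d / a\<^sup>2 + (k - 2 - d) / (1 - a)\<^sup>2 + (1 / a\<^sup>2 - 1 / (1 - a)\<^sup>2) * m)"
proof -
  have "a\<^sup>2 \<le> (1 - a)\<^sup>2"
    using assms by (intro power_mono) auto
  then have "1 / (1 - a)\<^sup>2 \<le> 1 / a\<^sup>2"
    using assms by (intro divide_left_mono) auto
  then have "0 \<le> (1 / a\<^sup>2 - 1 / (1 - a)\<^sup>2) * (d + m)"
    using m by (intro mult_nonneg_nonneg) auto
  moreover have "d / a\<^sup>2 + (k - 2 - d) / (1 - a)\<^sup>2 + (1 / a\<^sup>2 - 1 / (1 - a)\<^sup>2) * m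
      = (k - 2) / (1 - a)\<^sup>2 + (1 / a\<^sup>2 - 1 / (1 - a)\<^sup>2) * (d + m)"
    by (simp add: diff_divide_distrib add_divide_distrib algebra_simps)
  moreover have "(k - 2) / (8 * (1 - a)\<^sup>2) = 1 / 8 * ((k - 2) / (1 - a)\<^sup>2)"
    by (simp only: times_divide_times_eq mult_1)
  ultimately show ?thesis
    by (simp only: mult_left_mono le_add_same_cancel1 zero_le_divide_1_iff zero_le_numeral)
qed

theorem lemma3p3:
  fixes H :: "'n::finite \<Rightarrow> 'n \<Rightarrow> bool"
    and k d :: nat
    and a :: real
    and \<mu> q :: "nat \<Rightarrow> real"
  assumes "CARD('n) = k"
    and "simple_graph H"
    and "regular_of_degree d H"
    and "0 < a" and "a < 1"
    and "\<forall>i j. 2 \<le> i \<and> i \<le> j \<and> j \<le> k \<longrightarrow> \<mu> j \<le> \<mu> i"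
    and "lists_eigenvalues_on (adj_matrix H) ones_perp {2..k} \<mu>"
    and "\<forall>i\<in>{2..k}. q i = 1 / 8 * (real d / a\<^sup>2 + (real k - 2 - real d) / (1 - a)\<^sup>2
                                   + (1 / a\<^sup>2 - 1 / (1 - a)\<^sup>2) * \<mu> i)"
  shows "lists_eigenvalues_on (Q_matrix H d a) ones_perp {2..k} q \<and>
         (a \<le> 1 / 2 \<longrightarrow> (\<forall>i\<in>{2..k}. q i \<ge> (real k - 2) / (8 * (1 - a)\<^sup>2)))"
proof -
  define s where "s = 1 / 8 * (real d / a\<^sup>2 + (real k - 2 - real d) / (1 - a)\<^sup>2)"
  define c where "c = 1 / 8 * (1 / a\<^sup>2 - 1 / (1 - a)\<^sup>2)"
  have Q: "Q_matrix H d a = s *\<^sub>R mat 1 + c *\<^sub>R adj_matrix H"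
    using assms(1) by (simp add: Q_matrix_def s_def c_def scaleR_add_right)
  have q: "q i = s + c * \<mu> i" if "i \<in> {2..k}" for i
    using assms(8) that by (simp add: s_def c_def distrib_left)
  have "card {2..k} = dim (ones_perp :: (real ^ 'n) set)"
    using assms(1) by (simp add: dim_ones_perp)
  then have "lists_eigenvalues_on (Q_matrix H d a) ones_perp {2..k} q"
    unfolding Q using assms(7) subspace_ones_perp q by (intro lists_eigenvalues_on_affine)
  moreover have "(real k - 2) / (8 * (1 - a)\<^sup>2) \<le> q i" if "a \<le> 1 / 2" and i: "i \<in> {2..k}" for i
  proof -
    obtain y where "y \<noteq> 0" "adj_matrix H *v y = \<mu> i *\<^sub>R y"
      using lists_eigenvalues_on_eigenvector [OF assms(7) i] by blast
    then have "\<bar>\<mu> i\<bar> \<le> real d"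
      using regular_eigenvalue_abs_le [OF assms(3)] by blast
    then have "- real d \<le> \<mu> i"
      by linarith
    then show ?thesis
      using affine_eigenvalue_lower_bound [OF \<open>0 < a\<close> \<open>a \<le> 1 / 2\<close>, of "real d" "\<mu> i" "real k"]
        bspec [OF assms(8) i] by argo
  qed
  ultimately show ?thesis
    by blast
qed

end
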